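(* For $u_{0}\in H^{1}(\Omega)\cap L^{1}(\Omega)$, the energy $E^{\varepsilon}(u_{0})$ converges to $E(u_{0})$ (as $\varepsilon\to0$) with $$\left|E^{\varepsilon}(u_{0})-E(u_{0})\right|\leq 4\varepsilon|\lambda|\,\|u_{0}\|_{L^{1}(\Omega)}.$$
   Context: Here $d\in\{1,2,3\}$; $\Omega=\mathbb{R}^{d}$, or $\Omega\subset\mathbb{R}^{d}$ is a bounded domain with homogeneous Dirichlet or periodic boundary conditions; functions are real-valued; $\lambda\in\mathbb{R}$; $0<\varepsilon\ll1$. $E(u_0)$ and $E^{\varepsilon}(u_0)$ denote the values at time $0$ of the energies of the logarithmic Klein-Gordon equation $u_{tt}-\Delta u+u+\lambda u\ln(|u|^{2})=0$ and of its regularization $u^{\varepsilon}_{tt}-\Delta u^{\varepsilon}+u^{\varepsilon}+\lambda u^{\varepsilon}\ln(\varepsilon^{2}+(u^{\varepsilon})^{2})=0$, for the same initial value $u_0$ and the same initial velocity $\gamma\in L^2(\Omega)$: $$E(u_0)=\int_{\Omega}\left[\gamma^{2}+|\nabla u_0|^{2}+(1-\lambda)u_0^{2}+\lambda u_0^{2}\ln(|u_0|^{2})\right]\mathrm{d}\mathbf{x},$$ $$E^{\varepsilon}(u_0)=\int_{\Omega}\left[\gamma^{2}+|\nabla u_0|^{2}+u_0^{2}+\lambda F_{\varepsilon}(u_0^{2})\right]\mathrm{d}\mathbf{x},$$ where $F_{\varepsilon}(\rho)=\int_0^{\rho}\ln(\varepsilon^2+s)\,\mathrm{d}s=\rho\ln(\varepsilon^{2}+\rho)+\varepsilon^{2}\ln(1+\frac{\rho}{\varepsilon^{2}})-\rho$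 for $\rho\ge0$, and $u_0^2\ln(|u_0|^2)$ is taken to be $0$ where $u_0=0$. *)

theory Defs
  imports "HOL-Analysis.Analysis"
begin

definition partial_derivative :: "'n \<Rightarrow> (real ^ 'n \<Rightarrow> real) \<Rightarrow> real ^ 'n \<Rightarrow> real"
  where "partial_derivative i f x = frechet_derivative f (at x) (axis i 1)"

primrec C_k :: "nat \<Rightarrow> (real ^ 'n \<Rightarrow> real) \<Rightarrow> bool" where
  "C_k 0 f \<longleftrightarrow> continuous_on UNIV f"
| "C_k (Suc k) f \<longleftrightarrow> f differentiable_on UNIV \<and> (\<forall>i. C_k k (partial_derivative i f))"

definition test_function :: "(real ^ 'n) set \<Rightarrow> (real ^ 'n \<Rightarrow> real) \<Rightarrow> bool"
  where "test_function \<Omega> \<phi> \<longleftrightarrow>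
    (\<forall>k. C_k k \<phi>) \<and> compact (closure {x. \<phi> x \<noteq> 0}) \<and> closure {x. \<phi> x \<noteq> 0} \<subseteq> \<Omega>"

text \<open>
  Elements of the function spaces are represented by functions on the whole type; only their
  values on \<open>\<Omega>\<close> matter.
\<close>

definition L1 :: "(real ^ 'n) set \<Rightarrow> (real ^ 'n \<Rightarrow> real) set"
  where "L1 \<Omega> = {u. integrable (lebesgue_on \<Omega>) u}"

definition L1_norm :: "(real ^ 'n) set \<Rightarrow> (real ^ 'n \<Rightarrow> real) \<Rightarrow> real"
  where "L1_norm \<Omega> u = (\<integral>x. \<bar>u x\<bar> \<partial>lebesgue_on \<Omega>)"

definition L2 :: "(real ^ 'n) set \<Rightarrow> (real ^ 'n \<Rightarrow> 'b::euclidean_space) set"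
  where "L2 \<Omega> = {f. f \<in> borel_measurable (lebesgue_on \<Omega>) \<and>
    integrable (lebesgue_on \<Omega>) (\<lambda>x. (norm (f x))\<^sup>2)}"

definition L1_loc :: "(real ^ 'n) set \<Rightarrow> (real ^ 'n \<Rightarrow> 'b::euclidean_space) set"
  where "L1_loc \<Omega> = {f. \<forall>K. compact K \<and> K \<subseteq> \<Omega> \<longrightarrow> f absolutely_integrable_on K}"

definition has_weak_gradient ::
    "(real ^ 'n) set \<Rightarrow> (real ^ 'n \<Rightarrow> real) \<Rightarrow> (real ^ 'n \<Rightarrow> real ^ 'n) \<Rightarrow> bool"
  where "has_weak_gradient \<Omega> u g \<longleftrightarrow> u \<in> L1_loc \<Omega> \<and> g \<in> L1_loc \<Omega> \<and>
    (\<forall>\<phi> i. test_function \<Omega> \<phi> \<longrightarrow>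
      (\<integral>x. u x * partial_derivative i \<phi> x \<partial>lebesgue_on \<Omega>) =
      - (\<integral>x. g x $ i * \<phi> x \<partial>lebesgue_on \<Omega>))"

text \<open>
  On an open set a weak gradient is unique up to a null set, so integrals over \<open>\<Omega>\<close> do not
  depend on the representative chosen here.
\<close>

definition weak_gradient :: "(real ^ 'n) set \<Rightarrow> (real ^ 'n \<Rightarrow> real) \<Rightarrow> real ^ 'n \<Rightarrow> real ^ 'n"
  where "weak_gradient \<Omega> u = (SOME g. has_weak_gradient \<Omega> u g)"

text \<open>
  No boundary condition is built in: the Sobolev spaces encoding homogeneous Dirichlet or periodic
  boundary conditions are subspaces of \<open>H1 \<Omega>\<close> with the same weak gradient on \<open>\<Omega>\<close>.
\<close>

definition H1 :: "(real ^ 'n) set \<Rightarrow> (real ^ 'n \<Rightarrow> real) set"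
  where "H1 \<Omega> = {u. u \<in> L2 \<Omega> \<and> (\<exists>g. has_weak_gradient \<Omega> u g \<and> g \<in> L2 \<Omega>)}"

definition bounded_domain :: "(real ^ 'n) set \<Rightarrow> bool"
  where "bounded_domain \<Omega> \<longleftrightarrow> open \<Omega> \<and> connected \<Omega> \<and> \<Omega> \<noteq> {} \<and> bounded \<Omega>"

text \<open>
  In the energy, \<open>u\<^sup>2 ln(|u|\<^sup>2)\<close> vanishes where \<open>u = 0\<close>, because the factor \<open>u\<^sup>2\<close> is zero and
  \<open>ln\<close> is total.
\<close>

definition energy ::
    "(real ^ 'n) set \<Rightarrow> real \<Rightarrow> (real ^ 'n \<Rightarrow> real) \<Rightarrow> (real ^ 'n \<Rightarrow> real) \<Rightarrow> real"
  where "energy \<Omega> lam \<gamma> u = (\<integral>x. (\<gamma> x)\<^sup>2 + (norm (weak_gradient \<Omega> u x))\<^sup>2 + (1 - lam) * (u x)\<^sup>2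
    + lam * (u x)\<^sup>2 * ln (\<bar>u x\<bar>\<^sup>2) \<partial>lebesgue_on \<Omega>)"

definition F_reg :: "real \<Rightarrow> real \<Rightarrow> real"
  where "F_reg \<epsilon> \<rho> = integral {0..\<rho>} (\<lambda>s. ln (\<epsilon>\<^sup>2 + s))"

definition energy_reg ::
    "real \<Rightarrow> (real ^ 'n) set \<Rightarrow> real \<Rightarrow> (real ^ 'n \<Rightarrow> real) \<Rightarrow> (real ^ 'n \<Rightarrow> real) \<Rightarrow> real"
  where "energy_reg \<epsilon> \<Omega> lam \<gamma> u = (\<integral>x. (\<gamma> x)\<^sup>2 + (norm (weak_gradient \<Omega> u x))\<^sup>2 + (u x)\<^sup>2
    + lam * F_reg \<epsilon> ((u x)\<^sup>2) \<partial>lebesgue_on \<Omega>)"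

end

theory Submission
  imports Defs
begin

text \<open>
  The two energy densities differ only by \<open>\<lambda>\<close> times
  \<open>F\<^sub>\<epsilon>(u\<^sup>2) - (u\<^sup>2 ln(u\<^sup>2) - u\<^sup>2)\<close>, the difference of the primitives of
  \<open>ln(\<epsilon>\<^sup>2 + s)\<close> and \<open>ln s\<close> on \<open>[0, u\<^sup>2]\<close>. In closed form it is
  \<open>u\<^sup>2 ln(1 + \<epsilon>\<^sup>2/u\<^sup>2) + \<epsilon>\<^sup>2 ln(1 + u\<^sup>2/\<epsilon>\<^sup>2)\<close>, symmetric in \<open>\<epsilon>\<close> and
  \<open>|u|\<close>. Since \<open>1 + x\<^sup>2 \<le> (1 + x)\<^sup>2\<close> for \<open>x \<ge> 0\<close>, one has \<open>ln(1 + x\<^sup>2) \<le> 2x\<close>, so each of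
  the two terms lies between \<open>0\<close> and \<open>2\<epsilon>|u|\<close> (lemma \<open>F_reg_defect_bounds\<close>). Integrating this
  pointwise bound gives the estimate, and the convergence follows by squeezing.

  The step from the pointwise bound to the energies rests on the defect being dominated by
  the integrable function \<open>4\<epsilon>|u|\<close>: perturbing a density by an integrable function does not
  affect whether it is integrable (lemma \<open>abs_integral_diff_le_of_integrable_diff\<close>). The estimate
  thus holds, with the Bochner integral of a non-integrable function being \<open>0\<close>, even for those
  \<open>u\<close> whose logarithmic energy density fails to be integrable; otherwise it is linearity
  of the integral.
\<close>

lemma F_reg_closed_form:
  assumes "\<epsilon> > 0" "\<rho> \<ge> 0"
  shows "F_reg \<epsilon> \<rho> = (\<epsilon>\<^sup>2 + \<rho>) * ln (\<epsilon>\<^sup>2 + \<rho>) - \<epsilon>\<^sup>2 * ln (\<epsilon>\<^sup>2) - \<rho>"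
proof -
  let ?G = "\<lambda>s. (\<epsilon>\<^sup>2 + s) * ln (\<epsilon>\<^sup>2 + s) - s"
  have "((\<lambda>s. ln (\<epsilon>\<^sup>2 + s)) has_integral (?G \<rho> - ?G 0)) {0..\<rho>}"
  proof (rule fundamental_theorem_of_calculus)
    fix s assume "s \<in> {0..\<rho>}"
    then have "\<epsilon>\<^sup>2 + s > 0"
      using assms by (simp add: add_pos_nonneg)
    then have "(?G has_real_derivative ln (\<epsilon>\<^sup>2 + s)) (at s within {0..\<rho>})"
      by (auto intro!: derivative_eq_intros)
    then show "(?G has_vector_derivative ln (\<epsilon>\<^sup>2 + s)) (at s within {0..\<rho>})"
      by (simp add: has_real_derivative_iff_has_vector_derivative)
  qed (use assms in simp)
  then show ?thesis
    unfolding F_reg_def by (simp add: integral_unique)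
qed

text \<open>
  With \<open>x = b/a\<close> this is \<open>ln(1 + x\<^sup>2) \<le> 2 ln(1 + x) \<le> 2x\<close>. The case \<open>a = 0\<close> is included
  because the factor \<open>a\<^sup>2\<close> then annihilates the logarithms.
\<close>

lemma square_times_ln_diff_bounds:
  fixes a b :: real
  assumes "a \<ge> 0" "b \<ge> 0"
  shows "0 \<le> a\<^sup>2 * (ln (a\<^sup>2 + b\<^sup>2) - ln (a\<^sup>2))"
    and "a\<^sup>2 * (ln (a\<^sup>2 + b\<^sup>2) - ln (a\<^sup>2)) \<le> 2 * a * b"
proof -
  have "0 \<le> a\<^sup>2 * (ln (a\<^sup>2 + b\<^sup>2) - ln (a\<^sup>2)) \<and>
    a\<^sup>2 * (ln (a\<^sup>2 + b\<^sup>2) - ln (a\<^sup>2)) \<le> 2 * a * b"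
  proof (cases "a = 0")
    case False
    define x where "x = b / a"
    have a: "a > 0" and x: "x \<ge> 0" and b: "b = a * x"
      using False assms by (auto simp: x_def)
    have "a\<^sup>2 + b\<^sup>2 = a\<^sup>2 * (1 + x\<^sup>2)"
      by (simp add: b algebra_simps power2_eq_square)
    moreover have "1 + x\<^sup>2 > 0"
      by (simp add: add_pos_nonneg)
    ultimately have diff: "ln (a\<^sup>2 + b\<^sup>2) - ln (a\<^sup>2) = ln (1 + x\<^sup>2)"
      using a by (simp add: ln_mult)
    have "ln (1 + x\<^sup>2) \<le> ln ((1 + x)\<^sup>2)"
      using x by (subst ln_le_cancel_iff) (auto simp: add_pos_nonneg power2_sum)
    also have "\<dots> = 2 * ln (1 + x)"
      using x by (simp add: ln_realpow)
    also have "\<dots> \<le> 2 * x"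
      using ln_add_one_self_le_self[OF x] by simp
    finally have "a\<^sup>2 * ln (1 + x\<^sup>2) \<le> a\<^sup>2 * (2 * x)"
      by (intro mult_left_mono) auto
    also have "\<dots> = 2 * a * b"
      by (simp add: b power2_eq_square)
    finally show ?thesis
      unfolding diff by simp
  qed simp
  then show "0 \<le> a\<^sup>2 * (ln (a\<^sup>2 + b\<^sup>2) - ln (a\<^sup>2))"
    and "a\<^sup>2 * (ln (a\<^sup>2 + b\<^sup>2) - ln (a\<^sup>2)) \<le> 2 * a * b"
    by auto
qed

text \<open>
  The closed form splits the defect into two copies of the expression bounded in
  \<open>square_times_ln_diff_bounds\<close>, with the roles of \<open>\<epsilon>\<close> and \<open>|t|\<close> exchanged; each
  contributes \<open>2\<epsilon>|t|\<close>.
\<close>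

lemma F_reg_defect_bounds:
  assumes "\<epsilon> > 0"
  shows "0 \<le> F_reg \<epsilon> (t\<^sup>2) - (t\<^sup>2 * ln (t\<^sup>2) - t\<^sup>2)"
    and "F_reg \<epsilon> (t\<^sup>2) - (t\<^sup>2 * ln (t\<^sup>2) - t\<^sup>2) \<le> 4 * \<epsilon> * \<bar>t\<bar>"
proof -
  have split: "F_reg \<epsilon> (t\<^sup>2) - (t\<^sup>2 * ln (t\<^sup>2) - t\<^sup>2) =
      t\<^sup>2 * (ln (t\<^sup>2 + \<epsilon>\<^sup>2) - ln (t\<^sup>2)) + \<epsilon>\<^sup>2 * (ln (\<epsilon>\<^sup>2 + t\<^sup>2) - ln (\<epsilon>\<^sup>2))"
    using assms by (simp add: F_reg_closed_form algebra_simps)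
  show "0 \<le> F_reg \<epsilon> (t\<^sup>2) - (t\<^sup>2 * ln (t\<^sup>2) - t\<^sup>2)"
    and "F_reg \<epsilon> (t\<^sup>2) - (t\<^sup>2 * ln (t\<^sup>2) - t\<^sup>2) \<le> 4 * \<epsilon> * \<bar>t\<bar>"
    unfolding split
    using square_times_ln_diff_bounds[of "\<bar>t\<bar>" \<epsilon>] square_times_ln_diff_bounds[of \<epsilon> "\<bar>t\<bar>"] assms
    by (simp_all add: mult.commute mult.left_commute)
qed

text \<open>
  Either both functions are integrable and the bound is linearity and monotonicity of the
  integral, or neither is and both integrals have the value \<open>0\<close>.
\<close>

lemma abs_integral_diff_le_of_integrable_diff:
  fixes f g h :: "'a \<Rightarrow> real"
  assumes diff: "integrable M (\<lambda>x. f x - g x)" and h: "integrable M h"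
    and le: "\<And>x. \<bar>f x - g x\<bar> \<le> h x"
  shows "\<bar>(\<integral>x. f x \<partial>M) - (\<integral>x. g x \<partial>M)\<bar> \<le> (\<integral>x. h x \<partial>M)"
proof (cases "integrable M g")
  case True
  have f: "integrable M f"
    using Bochner_Integration.integrable_add[OF diff True] by simp
  have "\<bar>(\<integral>x. f x \<partial>M) - (\<integral>x. g x \<partial>M)\<bar> = \<bar>\<integral>x. f x - g x \<partial>M\<bar>"
    using f True by simp
  also have "\<dots> \<le> (\<integral>x. \<bar>f x - g x\<bar> \<partial>M)"
    by (rule integral_abs_bound)
  also have "\<dots> \<le> (\<integral>x. h x \<partial>M)"
    using diff h le by (intro integral_mono) auto
  finally show ?thesis .
next
  case False
  have "\<not> integrable M f"
    using Bochner_Integration.integrable_diff[OF _ diff, of f] False by auto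
  moreover have "0 \<le> (\<integral>x. h x \<partial>M)"
    using order_trans[OF abs_ge_zero le] by (intro integral_nonneg_AE) auto
  ultimately show ?thesis
    using False by (simp add: not_integrable_integral_eq)
qed

lemma energy_reg_error_bound:
  assumes u: "u \<in> L1 \<Omega>" and \<epsilon>: "\<epsilon> > 0"
  shows "\<bar>energy_reg \<epsilon> \<Omega> lam \<gamma> u - energy \<Omega> lam \<gamma> u\<bar> \<le> 4 * \<epsilon> * \<bar>lam\<bar> * L1_norm \<Omega> u"
proof -
  let ?M = "lebesgue_on \<Omega>"
  let ?f = "\<lambda>x. (\<gamma> x)\<^sup>2 + (norm (weak_gradient \<Omega> u x))\<^sup>2 + (u x)\<^sup>2 + lam * F_reg \<epsilon> ((u x)\<^sup>2)"
  let ?g = "\<lambda>x. (\<gamma> x)\<^sup>2 + (norm (weak_gradient \<Omega> u x))\<^sup>2 + (1 - lam) * (u x)\<^sup>2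
    + lam * (u x)\<^sup>2 * ln (\<bar>u x\<bar>\<^sup>2)"
  let ?d = "\<lambda>t. lam * (F_reg \<epsilon> (t\<^sup>2) - (t\<^sup>2 * ln (t\<^sup>2) - t\<^sup>2))"
  let ?h = "\<lambda>x. 4 * \<epsilon> * \<bar>lam\<bar> * \<bar>u x\<bar>"
  have int_u: "integrable ?M u"
    using u by (simp add: L1_def)
  then have int_h: "integrable ?M ?h"
    by (intro integrable_mult_right integrable_abs)
  have diff: "?f x - ?g x = ?d (u x)" for x
    by (simp add: algebra_simps)
  have bound: "\<bar>?d t\<bar> \<le> 4 * \<epsilon> * \<bar>lam\<bar> * \<bar>t\<bar>" for t
  proof -
    have "\<bar>?d t\<bar> \<le> \<bar>lam\<bar> * (4 * \<epsilon> * \<bar>t\<bar>)"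
      unfolding abs_mult using F_reg_defect_bounds[OF \<epsilon>, of t]
      by (intro mult_left_mono) auto
    then show ?thesis
      by (simp add: algebra_simps)
  qed
  have "(\<lambda>x. ?d (u x)) \<in> borel_measurable ?M"
    using borel_measurable_integrable[OF int_u] by (simp add: F_reg_closed_form[OF \<epsilon>])
  then have "integrable ?M (\<lambda>x. ?d (u x))"
    by (rule Bochner_Integration.integrable_bound[OF int_h])
      (intro AE_I2, use bound \<epsilon> in \<open>simp add: abs_mult\<close>)
  then have "\<bar>(\<integral>x. ?f x \<partial>?M) - (\<integral>x. ?g x \<partial>?M)\<bar> \<le> (\<integral>x. ?h x \<partial>?M)"
    using int_h bound by (intro abs_integral_diff_le_of_integrable_diff) (simp_all only: diff)
  then show ?thesis
    by (simp add: energy_reg_def energy_def L1_norm_def)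
qed

theorem theorem2p2:
  fixes \<Omega> :: "(real ^ 'n) set"
    and lam :: real
    and \<gamma> u0 :: "real ^ 'n \<Rightarrow> real"
  assumes "CARD('n) \<in> {1, 2, 3}"
    and "\<Omega> = UNIV \<or> bounded_domain \<Omega>"
    and "\<gamma> \<in> L2 \<Omega>"
    and "u0 \<in> H1 \<Omega> \<inter> L1 \<Omega>"
  shows "((\<lambda>\<epsilon>. energy_reg \<epsilon> \<Omega> lam \<gamma> u0) \<longlongrightarrow> energy \<Omega> lam \<gamma> u0) (at_right 0) \<and>
    (\<forall>\<epsilon>>0. \<bar>energy_reg \<epsilon> \<Omega> lam \<gamma> u0 - energy \<Omega> lam \<gamma> u0\<bar> \<le> 4 * \<epsilon> * \<bar>lam\<bar> * L1_norm \<Omega> u0)"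
proof
  show bound: "\<forall>\<epsilon>>0. \<bar>energy_reg \<epsilon> \<Omega> lam \<gamma> u0 - energy \<Omega> lam \<gamma> u0\<bar>
      \<le> 4 * \<epsilon> * \<bar>lam\<bar> * L1_norm \<Omega> u0"
    using assms(4) energy_reg_error_bound by blast
  have "((\<lambda>\<epsilon>. 4 * \<epsilon> * \<bar>lam\<bar> * L1_norm \<Omega> u0) \<longlongrightarrow> 4 * 0 * \<bar>lam\<bar> * L1_norm \<Omega> u0) (at_right 0)"
    by (intro tendsto_intros)
  then have "((\<lambda>\<epsilon>. 4 * \<epsilon> * \<bar>lam\<bar> * L1_norm \<Omega> u0) \<longlongrightarrow> 0) (at_right 0)"
    by simp
  then have "((\<lambda>\<epsilon>. energy_reg \<epsilon> \<Omega> lam \<gamma> u0 - energy \<Omega> lam \<gamma> u0) \<longlongrightarrow> 0) (at_right 0)"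
    by (rule Lim_null_comparison[rotated])
      (use bound in \<open>auto simp: eventually_at_right_less intro: eventually_at_rightI[of 0 1]\<close>)
  then show "((\<lambda>\<epsilon>. energy_reg \<epsilon> \<Omega> lam \<gamma> u0) \<longlongrightarrow> energy \<Omega> lam \<gamma> u0) (at_right 0)"
    by (simp add: LIM_zero_iff)
qed

end
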